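(* Let $c\in\pm\mathcal E_n'$, consider $(c,e_0)\in\mathcal A_{n+1}$, and put $\chi=\gamma_n\frac{n(c)}{n(e_0)}=\gamma_n n(c)$. Then $(c,e_0)$ is a zero divisor in $\mathcal A_{n+1}$, i.e. (up to sign) belongs to $Z_e'(\mathcal A_{n+1})$, if and only if $\chi=1$, and in this case $(c,e_0)$ is orthogonal to an element $(a,b)\in Z_e'(\mathcal A_{n+1})$ if and only if $ab=n(b)c$.
   Context: Real Cayley–Dickson algebras: $\mathcal A_0=\mathbb R$ with trivial involution. Given parameters $\gamma_0,\gamma_1,\dots\in\{\pm1\}$ (the paper's normalization of nonzero real parameters), $\mathcal A_{k+1}=\mathcal A_k\times\mathcal A_k$ with componentwise addition and real scaling, product $(a,b)(c,d)=(ac+\gamma_k\bar d b,\ da+b\bar c)$ and involution $\overline{(a,b)}=(\bar a,-b)$. The norm is $n(a)=a\bar a\in\mathbb R$. Standard basis: $e^{(0)}_0=1$; $e^{(k+1)}_j=(e^{(k)}_j,0)$ for $0\le j<2^k$ and $e^{(k+1)}_j=(0,e^{(k)}_{j-2^k})$ for $2^k\le j<2^{k+1}$; $e_0=e_0^{(n)}$ is the unity. $\mathcal E_n=\{e_0^{(n)},\dots,e^{(n)}_{2^n-1}\}$, $\mathcal E_n'=\mathcal E_n\setminus\{e_0\}$, $\pm X=X\cup(-X)$. $Z_e'(\mathcal A_{n+1})$ is the set of zero divisors of $\mathcal A_{n+1}$ of the form $(x,y)$ with $x\in\mathcal E_n'$, $y\in\pm\mathcal E_n$; zero divisors are considered up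 to multiplication by $\pm1$. Elements $x,y$ are orthogonal if $xy=yx=0$. A zero divisor is a nonzero $x$ with $xy=0$ or $yx=0$ for some $y\neq0$. *)

theory Defs
  imports Complex_Main
begin

text \<open>
  All algebras of the Cayley-Dickson tower live in one type of binary trees with real
  leaves: \<open>A\<^sub>0\<close> consists of the leaves, \<open>A\<^bsub>k+1\<^esub>\<close> of the pairs of elements of \<open>A\<^sub>k\<close>.
  The operations are meaningful only for arguments of one common level; on other
  arguments they are unspecified.
\<close>

datatype cd = CD_Real real | CD_Pair cd cd

fun cd_carrier :: "nat \<Rightarrow> cd set" where
  "cd_carrier 0 = range CD_Real"
| "cd_carrier (Suc k) = {CD_Pair a b | a b. a \<in> cd_carrier k \<and> b \<in> cd_carrier k}"

fun cd_zero :: "nat \<Rightarrow> cd" where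
  "cd_zero 0 = CD_Real 0"
| "cd_zero (Suc k) = CD_Pair (cd_zero k) (cd_zero k)"

fun cd_add :: "cd \<Rightarrow> cd \<Rightarrow> cd" where
  "cd_add (CD_Real r) (CD_Real s) = CD_Real (r + s)"
| "cd_add (CD_Pair a b) (CD_Pair c d) = CD_Pair (cd_add a c) (cd_add b d)"

fun cd_scale :: "real \<Rightarrow> cd \<Rightarrow> cd" where
  "cd_scale r (CD_Real s) = CD_Real (r * s)"
| "cd_scale r (CD_Pair a b) = CD_Pair (cd_scale r a) (cd_scale r b)"

definition cd_neg :: "cd \<Rightarrow> cd" where
  "cd_neg x = cd_scale (- 1) x"

fun cd_conj :: "cd \<Rightarrow> cd" where
  "cd_conj (CD_Real r) = CD_Real r"
| "cd_conj (CD_Pair a b) = CD_Pair (cd_conj a) (cd_neg b)"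

text \<open>\<open>cd_mult \<gamma> k\<close> is the product of \<open>A\<^sub>k\<close>; it depends on \<open>\<gamma> 0, \<dots>, \<gamma> (k - 1)\<close> only.\<close>

fun cd_mult :: "(nat \<Rightarrow> real) \<Rightarrow> nat \<Rightarrow> cd \<Rightarrow> cd \<Rightarrow> cd" where
  "cd_mult \<gamma> 0 (CD_Real r) (CD_Real s) = CD_Real (r * s)"
| "cd_mult \<gamma> (Suc k) (CD_Pair a b) (CD_Pair c d) =
     CD_Pair (cd_add (cd_mult \<gamma> k a c) (cd_scale (\<gamma> k) (cd_mult \<gamma> k (cd_conj d) b)))
             (cd_add (cd_mult \<gamma> k d a) (cd_mult \<gamma> k b (cd_conj c)))"

text \<open>Only the indices \<open>j < 2 ^ k\<close> are meaningful.\<close>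

fun cd_basis :: "nat \<Rightarrow> nat \<Rightarrow> cd" where
  "cd_basis 0 j = CD_Real 1"
| "cd_basis (Suc k) j =
     (if j < 2 ^ k then CD_Pair (cd_basis k j) (cd_zero k)
      else CD_Pair (cd_zero k) (cd_basis k (j - 2 ^ k)))"

definition cd_one :: "nat \<Rightarrow> cd" where
  "cd_one k = cd_basis k 0"

definition cd_E :: "nat \<Rightarrow> cd set" where
  "cd_E k = cd_basis k ` {0..<2 ^ k}"

definition cd_E' :: "nat \<Rightarrow> cd set" where
  "cd_E' k = cd_E k - {cd_one k}"

definition pm :: "cd set \<Rightarrow> cd set" where
  "pm X = X \<union> cd_neg ` X"

text \<open>
  The real number \<open>n(a)\<close> with \<open>a * cnj a = n(a) * 1\<close>, reals being identified with the
  multiples of the unity; see \<open>cd_norm_eq\<close> below for existence and uniqueness.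
\<close>

definition cd_norm :: "(nat \<Rightarrow> real) \<Rightarrow> nat \<Rightarrow> cd \<Rightarrow> real" where
  "cd_norm \<gamma> k a = (THE r. cd_mult \<gamma> k a (cd_conj a) = cd_scale r (cd_one k))"

definition cd_orthogonal :: "(nat \<Rightarrow> real) \<Rightarrow> nat \<Rightarrow> cd \<Rightarrow> cd \<Rightarrow> bool" where
  "cd_orthogonal \<gamma> k x y \<longleftrightarrow> cd_mult \<gamma> k x y = cd_zero k \<and> cd_mult \<gamma> k y x = cd_zero k"

definition cd_zero_divisor :: "(nat \<Rightarrow> real) \<Rightarrow> nat \<Rightarrow> cd \<Rightarrow> bool" where
  "cd_zero_divisor \<gamma> k x \<longleftrightarrow>
     x \<in> cd_carrier k \<and> x \<noteq> cd_zero k \<and>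
     (\<exists>y\<in>cd_carrier k. y \<noteq> cd_zero k \<and>
        (cd_mult \<gamma> k x y = cd_zero k \<or> cd_mult \<gamma> k y x = cd_zero k))"

text \<open>\<open>cd_Z' \<gamma> n\<close> is a set of zero divisors of \<open>A\<^bsub>n+1\<^esub>\<close>, not of \<open>A\<^sub>n\<close>.\<close>

definition cd_Z' :: "(nat \<Rightarrow> real) \<Rightarrow> nat \<Rightarrow> cd set" where
  "cd_Z' \<gamma> n =
     {CD_Pair x y | x y. x \<in> cd_E' n \<and> y \<in> pm (cd_E n) \<and>
        cd_zero_divisor \<gamma> (Suc n) (CD_Pair x y)}"

lemma cd_zero_carrier [simp]: "cd_zero k \<in> cd_carrier k"
  by (induction k) auto

lemma cd_scale_carrier: "x \<in> cd_carrier k \<Longrightarrow> cd_scale r x \<in> cd_carrier k"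
  by (induction k arbitrary: x) auto

lemma cd_conj_carrier: "x \<in> cd_carrier k \<Longrightarrow> cd_conj x \<in> cd_carrier k"
  by (induction k arbitrary: x) (auto simp: cd_neg_def cd_scale_carrier)

lemma cd_add_carrier:
  "x \<in> cd_carrier k \<Longrightarrow> y \<in> cd_carrier k \<Longrightarrow> cd_add x y \<in> cd_carrier k"
  by (induction k arbitrary: x y) auto

lemma cd_mult_carrier:
  "x \<in> cd_carrier k \<Longrightarrow> y \<in> cd_carrier k \<Longrightarrow> cd_mult \<gamma> k x y \<in> cd_carrier k"
  by (induction k arbitrary: x y)
    (auto simp: cd_scale_carrier cd_conj_carrier cd_add_carrier)

lemma cd_scale_scale: "cd_scale r (cd_scale s x) = cd_scale (r * s) x"
  by (induction x) auto

lemma cd_scale_one [simp]: "cd_scale 1 x = x"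
  by (induction x) auto

lemma cd_scale_zero [simp]: "cd_scale r (cd_zero k) = cd_zero k"
  by (induction k) auto

lemma cd_conj_scale: "cd_conj (cd_scale r x) = cd_scale r (cd_conj x)"
  by (induction x) (auto simp: cd_neg_def cd_scale_scale mult.commute)

lemma cd_conj_conj [simp]: "cd_conj (cd_conj x) = x"
  by (induction x) (auto simp: cd_neg_def cd_scale_scale)

lemma cd_scale_add:
  "x \<in> cd_carrier k \<Longrightarrow> y \<in> cd_carrier k \<Longrightarrow>
   cd_scale r (cd_add x y) = cd_add (cd_scale r x) (cd_scale r y)"
  by (induction k arbitrary: x y) (auto simp: algebra_simps)

lemma cd_add_scale:
  "cd_add (cd_scale r x) (cd_scale s x) = cd_scale (r + s) x"
  by (induction x) (auto simp: algebra_simps)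

lemma cd_scale_0: "x \<in> cd_carrier k \<Longrightarrow> cd_scale 0 x = cd_zero k"
  by (induction k arbitrary: x) auto

lemma cd_mult_scale:
  "x \<in> cd_carrier k \<Longrightarrow> y \<in> cd_carrier k \<Longrightarrow>
     cd_mult \<gamma> k (cd_scale r x) y = cd_scale r (cd_mult \<gamma> k x y) \<and>
     cd_mult \<gamma> k x (cd_scale r y) = cd_scale r (cd_mult \<gamma> k x y)"
proof (induction k arbitrary: x y)
  case 0
  then show ?case by auto
next
  case (Suc k)
  then obtain a b c d where [simp]: "x = CD_Pair a b" "y = CD_Pair c d"
    and in_k: "a \<in> cd_carrier k" "b \<in> cd_carrier k" "c \<in> cd_carrier k" "d \<in> cd_carrier k"
    by auto
  show ?case
    using in_k Suc.IH
    by (simp add: cd_conj_scale cd_conj_carrier cd_mult_carrier cd_scale_carrier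
        cd_scale_add[of _ k] cd_scale_scale mult.commute)
qed

lemma cd_one_Suc: "cd_one (Suc k) = CD_Pair (cd_one k) (cd_zero k)"
  by (simp add: cd_one_def)

lemma cd_one_carrier: "cd_one k \<in> cd_carrier k"
  by (induction k) (auto simp: cd_one_Suc, auto simp: cd_one_def)

lemma cd_scale_one_inject: "cd_scale r (cd_one k) = cd_scale s (cd_one k) \<Longrightarrow> r = s"
  by (induction k) (auto simp: cd_one_Suc, auto simp: cd_one_def)

lemma cd_mult_conj_real:
  assumes "a \<in> cd_carrier k"
  shows "\<exists>r. cd_mult \<gamma> k a (cd_conj a) = cd_scale r (cd_one k) \<and>
             cd_mult \<gamma> k (cd_conj a) a = cd_scale r (cd_one k)"
  using assms
proof (induction k arbitrary: a)
  case 0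
  then show ?case by (auto simp: cd_one_def)
next
  case (Suc k)
  then obtain x y where a: "a = CD_Pair x y"
    and x: "x \<in> cd_carrier k" and y: "y \<in> cd_carrier k"
    by auto
  obtain r where r: "cd_mult \<gamma> k x (cd_conj x) = cd_scale r (cd_one k)"
      "cd_mult \<gamma> k (cd_conj x) x = cd_scale r (cd_one k)"
    using Suc.IH[OF x] by auto
  obtain s where s: "cd_mult \<gamma> k y (cd_conj y) = cd_scale s (cd_one k)"
      "cd_mult \<gamma> k (cd_conj y) y = cd_scale s (cd_one k)"
    using Suc.IH[OF y] by auto
  have cancel: "cd_add (cd_scale (- 1) z) z = cd_zero k \<and> cd_add z (cd_scale (- 1) z) = cd_zero k"
    if "z \<in> cd_carrier k" for z
    using cd_add_scale[of "- 1" z 1] cd_add_scale[of 1 z "- 1"] cd_scale_0[OF that] by simp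
  show ?case
    using x y r s
    by (intro exI[of _ "r - \<gamma> k * s"])
      (simp add: a cd_one_Suc cd_neg_def cd_conj_scale cd_mult_scale cd_conj_carrier
        cd_scale_carrier cd_scale_scale cd_add_scale cancel cd_mult_carrier)
qed

lemma cd_norm_eq:
  assumes "a \<in> cd_carrier k"
  shows "cd_mult \<gamma> k a (cd_conj a) = cd_scale r (cd_one k) \<longleftrightarrow> cd_norm \<gamma> k a = r"
proof -
  obtain s where "cd_mult \<gamma> k a (cd_conj a) = cd_scale s (cd_one k)"
    using cd_mult_conj_real[OF assms] by blast
  then have eq: "cd_mult \<gamma> k a (cd_conj a) = cd_scale r (cd_one k) \<longleftrightarrow> r = s" for r
    using cd_scale_one_inject[of s k r] by auto
  show ?thesis
    by (auto simp: cd_norm_def eq)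
qed

end

theory Submission
  imports Defs
begin

text \<open>
  Standard basis elements \<open>e\<close> are strongly alternative: multiplying any \<open>x\<close> by \<open>e\<close> and then,
  on the same side, by its conjugate gives \<open>n(e) x\<close>. Therefore
  \<open>(c, 1) (x, y) = (c x + \<gamma> cnj y, y c + cnj x)\<close> vanishes iff \<open>x = c (cnj y)\<close> and
  \<open>(\<gamma> - n(c)) y = 0\<close>, and symmetrically on the other side. For \<open>\<gamma> = n(c)\<close> and imaginary \<open>a\<close>
  the two orthogonality conditions \<open>a = c (cnj b)\<close> and \<open>a = b c\<close> are conjugate to each other,
  and multiplying the first one by \<open>b\<close> or \<open>cnj b\<close> turns it into \<open>a b = n(b) c\<close> and back.
\<close>

section \<open>Addition, scaling, conjugation and the unity in the tower\<close>

lemma cd_add_commute: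
  "x \<in> cd_carrier k \<Longrightarrow> y \<in> cd_carrier k \<Longrightarrow> cd_add x y = cd_add y x"
  by (induction k arbitrary: x y) auto

lemma cd_add_zero:
  assumes "x \<in> cd_carrier k"
  shows "cd_add x (cd_zero k) = x" "cd_add (cd_zero k) x = x"
  using assms by (induction k arbitrary: x) auto

lemma cd_add_eq_zero_iff:
  "x \<in> cd_carrier k \<Longrightarrow> y \<in> cd_carrier k \<Longrightarrow>
   cd_add x y = cd_zero k \<longleftrightarrow> y = cd_scale (- 1) x"
  by (induction k arbitrary: x y) auto

lemma cd_scale_eq_zero_iff:
  "x \<in> cd_carrier k \<Longrightarrow> cd_scale r x = cd_zero k \<longleftrightarrow> r = 0 \<or> x = cd_zero k"
  by (induction k arbitrary: x) auto

lemma cd_scale_minus_one_inject: "cd_scale (- 1) x = cd_scale (- 1) y \<longleftrightarrow> x = y"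
  by (metis cd_scale_one cd_scale_scale minus_mult_minus mult_1)

lemma cd_conj_zero [simp]: "cd_conj (cd_zero k) = cd_zero k"
  by (induction k) (auto simp: cd_neg_def)

lemma cd_conj_eq_zero_iff: "cd_conj x = cd_zero k \<longleftrightarrow> x = cd_zero k"
  by (metis cd_conj_conj cd_conj_zero)

lemma cd_conj_add:
  "x \<in> cd_carrier k \<Longrightarrow> y \<in> cd_carrier k \<Longrightarrow>
   cd_conj (cd_add x y) = cd_add (cd_conj x) (cd_conj y)"
  by (induction k arbitrary: x y) (auto simp: cd_neg_def cd_scale_add)

lemma cd_conj_one [simp]: "cd_conj (cd_one k) = cd_one k"
  by (induction k) (auto simp: cd_one_Suc cd_neg_def, auto simp: cd_one_def)

lemma cd_one_neq_zero: "cd_one k \<noteq> cd_zero k"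
  by (induction k) (auto simp: cd_one_Suc, auto simp: cd_one_def)

lemma cd_mult_zero:
  assumes "x \<in> cd_carrier k"
  shows "cd_mult \<gamma> k x (cd_zero k) = cd_zero k" "cd_mult \<gamma> k (cd_zero k) x = cd_zero k"
  \<comment> \<open>Scaling \<open>cd_zero k\<close> by 0 does not change it, so bilinearity makes
    each product equal to 0 times itself.\<close>
  using cd_mult_scale[OF assms cd_zero_carrier, of \<gamma> 0]
    cd_mult_scale[OF cd_zero_carrier assms, of \<gamma> 0]
    cd_scale_0[OF cd_mult_carrier[OF assms cd_zero_carrier]]
    cd_scale_0[OF cd_mult_carrier[OF cd_zero_carrier assms]]
  by simp_all

lemma cd_mult_one:
  assumes "x \<in> cd_carrier k"
  shows "cd_mult \<gamma> k x (cd_one k) = x" "cd_mult \<gamma> k (cd_one k) x = x"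
proof -
  have "cd_mult \<gamma> k x (cd_one k) = x \<and> cd_mult \<gamma> k (cd_one k) x = x"
    using assms
  proof (induction k arbitrary: x)
    case 0
    then show ?case by (auto simp: cd_one_def)
  next
    case (Suc k)
    then show ?case
      by (auto simp: cd_one_Suc cd_mult_zero cd_add_zero cd_conj_carrier)
  qed
  then show "cd_mult \<gamma> k x (cd_one k) = x" "cd_mult \<gamma> k (cd_one k) x = x" by auto
qed

text \<open>In the first component the induction hypothesis reverses \<open>a c\<close> and
  \<open>(cnj d) b\<close>. In the second component both sides are negated sums with the two
  summands in opposite order, whence the appeal to commutativity.\<close>

lemma cd_conj_mult:
  "x \<in> cd_carrier k \<Longrightarrow> y \<in> cd_carrier k \<Longrightarrow>
   cd_conj (cd_mult \<gamma> k x y) = cd_mult \<gamma> k (cd_conj y) (cd_conj x)"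
proof (induction k arbitrary: x y)
  case 0
  then show ?case by auto
next
  case (Suc k)
  then obtain a b c d where [simp]: "x = CD_Pair a b" "y = CD_Pair c d"
    and in_k: "a \<in> cd_carrier k" "b \<in> cd_carrier k" "c \<in> cd_carrier k" "d \<in> cd_carrier k"
    by auto
  show ?case
    using in_k
    by (simp add: Suc.IH cd_neg_def cd_conj_scale cd_conj_carrier cd_mult_carrier
        cd_scale_carrier cd_scale_add[of _ k] cd_conj_add[of _ k] cd_mult_scale cd_scale_scale
        cd_add_commute[of _ k])
qed

section \<open>The norm as a quadratic form and its behaviour under doubling\<close>

lemma cd_norm_scale:
  assumes "a \<in> cd_carrier k"
  shows "cd_norm \<gamma> k (cd_scale r a) = r\<^sup>2 * cd_norm \<gamma> k a"
proof -
  have "cd_mult \<gamma> k a (cd_conj a) = cd_scale (cd_norm \<gamma> k a) (cd_one k)"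
    using cd_norm_eq[OF assms] by blast
  then have "cd_mult \<gamma> k (cd_scale r a) (cd_conj (cd_scale r a)) =
      cd_scale (r\<^sup>2 * cd_norm \<gamma> k a) (cd_one k)"
    by (simp add: assms cd_conj_scale cd_mult_scale cd_conj_carrier cd_scale_carrier
        cd_scale_scale power2_eq_square mult.assoc)
  then show ?thesis
    using cd_norm_eq cd_scale_carrier[OF assms] by blast
qed

lemma cd_norm_zero [simp]: "cd_norm \<gamma> k (cd_zero k) = 0"
  using cd_norm_scale[OF cd_zero_carrier, of \<gamma> k 0] by simp

lemma cd_norm_one [simp]: "cd_norm \<gamma> k (cd_one k) = 1"
proof -
  have "cd_mult \<gamma> k (cd_one k) (cd_conj (cd_one k)) = cd_scale 1 (cd_one k)"
    by (simp add: cd_mult_one cd_one_carrier)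
  then show ?thesis
    using cd_norm_eq[OF cd_one_carrier] by blast
qed

text \<open>An element times its conjugate is the same real multiple of the unity in either
  order.\<close>

lemma cd_norm_conj:
  assumes "a \<in> cd_carrier k"
  shows "cd_norm \<gamma> k (cd_conj a) = cd_norm \<gamma> k a"
proof -
  obtain r where "cd_mult \<gamma> k a (cd_conj a) = cd_scale r (cd_one k)"
      "cd_mult \<gamma> k (cd_conj a) a = cd_scale r (cd_one k)"
    using cd_mult_conj_real[OF assms] by blast
  then have "cd_norm \<gamma> k a = r" "cd_norm \<gamma> k (cd_conj a) = r"
    using cd_norm_eq[OF assms] cd_norm_eq[OF cd_conj_carrier[OF assms]] by auto
  then show ?thesis by simp
qed

text \<open>In the product of \<open>(a, b)\<close> with \<open>(cnj a, - b)\<close> the second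
  component \<open>- b a + b a\<close> cancels. The first contains \<open>(cnj b) b\<close> rather
  than \<open>b (cnj b)\<close>, so the norm of \<open>b\<close> enters through that of its
  conjugate.\<close>

lemma cd_norm_Pair:
  assumes a: "a \<in> cd_carrier k" and b: "b \<in> cd_carrier k"
  shows "cd_norm \<gamma> (Suc k) (CD_Pair a b) = cd_norm \<gamma> k a - \<gamma> k * cd_norm \<gamma> k b"
proof -
  have na: "cd_mult \<gamma> k a (cd_conj a) = cd_scale (cd_norm \<gamma> k a) (cd_one k)"
    using cd_norm_eq[OF a] by blast
  have nb: "cd_mult \<gamma> k (cd_conj b) b = cd_scale (cd_norm \<gamma> k b) (cd_one k)"
    using cd_norm_eq[OF cd_conj_carrier[OF b], of \<gamma>] cd_norm_conj[OF b, of \<gamma>] by simp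
  have "cd_mult \<gamma> (Suc k) (CD_Pair a b) (cd_conj (CD_Pair a b)) =
      cd_scale (cd_norm \<gamma> k a - \<gamma> k * cd_norm \<gamma> k b) (cd_one (Suc k))"
    using a b
    by (simp add: na nb cd_one_Suc cd_neg_def cd_conj_scale cd_mult_scale cd_conj_carrier
        cd_scale_carrier cd_scale_scale cd_add_scale cd_mult_carrier cd_add_eq_zero_iff
        cd_add_commute[of _ k])
  then show ?thesis
    using cd_norm_eq[of "CD_Pair a b" "Suc k"] a b by simp
qed

section \<open>Norms and cancellation for standard basis elements\<close>

lemma cd_basis_carrier [simp]: "cd_basis k j \<in> cd_carrier k"
  by (induction k arbitrary: j) auto

text \<open>By \<open>cd_norm_Pair\<close>, each doubling either keeps the norm of a basis element
  or multiplies it by \<open>- \<gamma> k\<close>.\<close>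

lemma cd_basis_norm:
  assumes "\<And>i. \<gamma> i \<in> {1, - 1}"
  shows "cd_norm \<gamma> k (cd_basis k j) \<in> {1, - 1}"
proof (induction k arbitrary: j)
  case 0
  then show ?case
    using cd_norm_one[of \<gamma> 0] by (simp add: cd_one_def del: cd_norm_one)
next
  case (Suc k)
  show ?case
    using Suc.IH[of j] Suc.IH[of "j - 2 ^ k"] assms[of k] by (auto simp: cd_norm_Pair)
qed

lemma cd_basis_conj: "0 < j \<Longrightarrow> j < 2 ^ k \<Longrightarrow> cd_conj (cd_basis k j) = cd_neg (cd_basis k j)"
  by (induction k arbitrary: j) (auto simp: cd_neg_def)

text \<open>
  All four identities are needed at once: passing from \<open>A\<^sub>k\<close> to \<open>A\<^bsub>k+1\<^esub>\<close> mixes left with right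
  multiplications and \<open>e\<close> with its conjugate.
\<close>

lemma cd_basis_cancel:
  "x \<in> cd_carrier k \<Longrightarrow> e = cd_basis k j \<Longrightarrow> s = cd_norm \<gamma> k e \<Longrightarrow>
   cd_mult \<gamma> k (cd_conj e) (cd_mult \<gamma> k e x) = cd_scale s x \<and>
   cd_mult \<gamma> k e (cd_mult \<gamma> k (cd_conj e) x) = cd_scale s x \<and>
   cd_mult \<gamma> k (cd_mult \<gamma> k x e) (cd_conj e) = cd_scale s x \<and>
   cd_mult \<gamma> k (cd_mult \<gamma> k x (cd_conj e)) e = cd_scale s x"
proof (induction k arbitrary: x e j s)
  case 0
  then show ?case
    using cd_norm_one[of \<gamma> 0] by (auto simp: cd_one_def simp del: cd_norm_one)
next
  case (Suc k)
  then obtain a b where [simp]: "x = CD_Pair a b"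
    and ab: "a \<in> cd_carrier k" "b \<in> cd_carrier k"
    by auto
  show ?case
  proof (cases "j < 2 ^ k")
    case True
    define f where "f = cd_basis k j"
    have f: "f \<in> cd_carrier k" "e = CD_Pair f (cd_zero k)"
      using Suc.prems True by (auto simp: f_def)
    then have s: "s = cd_norm \<gamma> k f"
      using Suc.prems(3) by (simp add: cd_norm_Pair)
    \<comment> \<open>Multiplication by \<open>(f, 0)\<close> acts on each component separately, by
      \<open>f\<close> or \<open>cnj f\<close> from one side: \<open>(f a, b f)\<close> on the left
      and \<open>(a f, b (cnj f))\<close> on the right.\<close>
    show ?thesis
      using ab f(1) Suc.IH[OF ab(1) f_def s] Suc.IH[OF ab(2) f_def s]
      by (simp add: f(2) cd_neg_def cd_mult_zero cd_add_zero cd_conj_carrier cd_mult_carrier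
          cd_scale_carrier)
  next
    case False
    define f where "f = cd_basis k (j - 2 ^ k)"
    define t where "t = cd_norm \<gamma> k f"
    have f: "f \<in> cd_carrier k" "e = CD_Pair (cd_zero k) f"
      using Suc.prems False by (auto simp: f_def)
    then have s: "s = - (\<gamma> k * t)"
      using Suc.prems(3) by (simp add: cd_norm_Pair t_def)
    \<comment> \<open>Multiplication by \<open>(0, f)\<close> interchanges the components, and from
      the left it also conjugates them. The second multiplication, by the conjugate, undoes this and
      leaves the factor \<open>- \<gamma> k * t\<close>.\<close>
    show ?thesis
      using ab f(1) Suc.IH[OF ab(1) f_def t_def] Suc.IH[OF ab(2) f_def t_def]
      by (simp add: f(2) s cd_neg_def cd_mult_zero cd_add_zero cd_conj_carrier cd_mult_carrier
          cd_conj_mult cd_conj_scale cd_mult_scale cd_scale_carrier cd_scale_scale)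
  qed
qed

section \<open>Basis elements up to sign\<close>

lemma cd_pm_basisE:
  assumes "e \<in> pm (cd_E k)"
  obtains t j where "t \<in> {1, - 1}" "j < 2 ^ k" "e = cd_scale t (cd_basis k j)"
proof -
  obtain j where "j < 2 ^ k" "e = cd_basis k j \<or> e = cd_scale (- 1) (cd_basis k j)"
    using assms by (auto simp: pm_def cd_E_def cd_neg_def)
  then show ?thesis
    using that[of 1 j] that[of "- 1" j] by auto
qed

lemma cd_pm_E_carrier: "e \<in> pm (cd_E k) \<Longrightarrow> e \<in> cd_carrier k"
  by (auto elim!: cd_pm_basisE intro: cd_scale_carrier)

lemma cd_pm_E_norm:
  assumes "\<And>i. \<gamma> i \<in> {1, - 1}" "e \<in> pm (cd_E k)"
  shows "cd_norm \<gamma> k e \<in> {1, - 1}"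
proof -
  obtain t j where "t \<in> {1, - 1}" "e = cd_scale t (cd_basis k j)"
    using assms(2) by (rule cd_pm_basisE)
  then show ?thesis
    using cd_basis_norm[of \<gamma> k j, OF assms(1)] by (auto simp: cd_norm_scale)
qed

text \<open>The sign in front of the basis element occurs twice in each product and squared in the
  norm, so the identities of \<open>cd_basis_cancel\<close> carry over.\<close>

lemma cd_pm_E_cancel:
  assumes "e \<in> pm (cd_E k)" and x: "x \<in> cd_carrier k"
  shows "cd_mult \<gamma> k (cd_conj e) (cd_mult \<gamma> k e x) = cd_scale (cd_norm \<gamma> k e) x"
    and "cd_mult \<gamma> k (cd_mult \<gamma> k x e) (cd_conj e) = cd_scale (cd_norm \<gamma> k e) x"
    and "cd_mult \<gamma> k (cd_mult \<gamma> k x (cd_conj e)) e = cd_scale (cd_norm \<gamma> k e) x"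
proof -
  obtain t j where t: "t \<in> {1, - 1}" and e: "e = cd_scale t (cd_basis k j)"
    using assms(1) by (rule cd_pm_basisE)
  have "t\<^sup>2 = 1" using t by auto
  then show "cd_mult \<gamma> k (cd_conj e) (cd_mult \<gamma> k e x) = cd_scale (cd_norm \<gamma> k e) x"
    and "cd_mult \<gamma> k (cd_mult \<gamma> k x e) (cd_conj e) = cd_scale (cd_norm \<gamma> k e) x"
    and "cd_mult \<gamma> k (cd_mult \<gamma> k x (cd_conj e)) e = cd_scale (cd_norm \<gamma> k e) x"
    using cd_basis_cancel[OF x refl refl, of \<gamma> j] x
    by (simp_all add: e cd_norm_scale cd_conj_scale cd_mult_scale cd_conj_carrier
        cd_scale_carrier cd_mult_carrier cd_scale_scale
        flip: power2_eq_square mult.assoc)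
qed

lemma cd_pm_E'_subset: "pm (cd_E' k) \<subseteq> pm (cd_E k)"
  by (auto simp: pm_def cd_E'_def)

lemma cd_pm_E'_conj:
  assumes "e \<in> pm (cd_E' k)"
  shows "cd_conj e = cd_scale (- 1) e"
proof -
  have E': "cd_conj f = cd_scale (- 1) f" if f: "f \<in> cd_E' k" for f
  proof -
    obtain j where "j < 2 ^ k" "f = cd_basis k j" "j \<noteq> 0"
      using f by (force simp: cd_E'_def cd_E_def cd_one_def)
    then show ?thesis
      using cd_basis_conj[of j k] by (simp add: cd_neg_def)
  qed
  show ?thesis
    using assms by (auto simp: pm_def cd_neg_def cd_conj_scale E')
qed

section \<open>Annihilators of \<open>(c, 1)\<close>\<close>

lemma cd_pair_one_mult_eq_zero_iff:
  assumes c: "c \<in> pm (cd_E' n)" and x: "x \<in> cd_carrier n" and y: "y \<in> cd_carrier n"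
  shows "cd_mult \<gamma> (Suc n) (CD_Pair c (cd_one n)) (CD_Pair x y) = cd_zero (Suc n) \<longleftrightarrow>
      x = cd_mult \<gamma> n c (cd_conj y) \<and> (\<gamma> n = cd_norm \<gamma> n c \<or> y = cd_zero n)"
    and "cd_mult \<gamma> (Suc n) (CD_Pair x y) (CD_Pair c (cd_one n)) = cd_zero (Suc n) \<longleftrightarrow>
      x = cd_mult \<gamma> n y c \<and> (\<gamma> n = cd_norm \<gamma> n c \<or> y = cd_zero n)"
proof -
  have cE: "c \<in> pm (cd_E n)" using c cd_pm_E'_subset by blast
  have cC: "c \<in> cd_carrier n" using cE by (rule cd_pm_E_carrier)
  note carr = cC x y cd_one_carrier cd_mult_carrier cd_conj_carrier cd_scale_carrier
  have cc: "cd_conj c = cd_scale (- 1) c" using c by (rule cd_pm_E'_conj)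
  have conj_yc: "cd_conj (cd_mult \<gamma> n y c) = cd_scale (- 1) (cd_mult \<gamma> n c (cd_conj y))"
    by (simp add: cd_conj_mult carr cc cd_mult_scale)
  \<comment> \<open>Since \<open>c\<close> is imaginary, \<open>cnj c = - c\<close>, and
    cancellation turns into multiplication by \<open>- n(c)\<close>.\<close>
  have sq_left: "cd_mult \<gamma> n c (cd_mult \<gamma> n c z) = cd_scale (- cd_norm \<gamma> n c) z"
    if "z \<in> cd_carrier n" for z
    using arg_cong[OF cd_pm_E_cancel(1)[OF cE that, of \<gamma>], of "cd_scale (- 1)"] that
    by (simp add: cc cd_mult_scale carr cd_scale_scale)
  have sq_right: "cd_mult \<gamma> n (cd_mult \<gamma> n z c) c = cd_scale (- cd_norm \<gamma> n c) z"
    if "z \<in> cd_carrier n" for z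
    using arg_cong[OF cd_pm_E_cancel(2)[OF cE that, of \<gamma>], of "cd_scale (- 1)"] that
    by (simp add: cc cd_mult_scale carr cd_scale_scale)
  \<comment> \<open>This is the first component once the value of \<open>x\<close> forced by the
    second one is substituted; \<open>z\<close> is \<open>cnj y\<close> for the product with
    \<open>(c, 1)\<close> on the left, and \<open>y\<close> for the other order.\<close>
  have coef: "cd_add (cd_scale (- cd_norm \<gamma> n c) z) (cd_scale (\<gamma> n) z) = cd_zero n \<longleftrightarrow>
      \<gamma> n = cd_norm \<gamma> n c \<or> z = cd_zero n" if "z \<in> cd_carrier n" for z
    using that by (auto simp: cd_add_scale cd_scale_eq_zero_iff)
  \<comment> \<open>The second component \<open>y c + cnj x\<close> of the product with
    \<open>(c, 1)\<close> on the left; conjugating it isolates \<open>x\<close>.\<close>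
  have "cd_add (cd_mult \<gamma> n y c) (cd_conj x) = cd_zero n \<longleftrightarrow> x = cd_mult \<gamma> n c (cd_conj y)"
  proof -
    have "cd_add (cd_mult \<gamma> n y c) (cd_conj x) = cd_zero n \<longleftrightarrow>
        cd_conj x = cd_scale (- 1) (cd_mult \<gamma> n y c)"
      by (simp add: cd_add_eq_zero_iff carr)
    also have "\<dots> \<longleftrightarrow> x = cd_conj (cd_scale (- 1) (cd_mult \<gamma> n y c))"
      by (metis cd_conj_conj)
    finally show ?thesis
      by (simp add: cd_conj_scale conj_yc cd_scale_scale)
  qed
  then show "cd_mult \<gamma> (Suc n) (CD_Pair c (cd_one n)) (CD_Pair x y) = cd_zero (Suc n) \<longleftrightarrow>
      x = cd_mult \<gamma> n c (cd_conj y) \<and> (\<gamma> n = cd_norm \<gamma> n c \<or> y = cd_zero n)"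
    using coef[of "cd_conj y"]
    by (auto simp: cd_mult_one carr sq_left cd_conj_eq_zero_iff)
  \<comment> \<open>In the other order the second component is
    \<open>x + y (cnj c) = x - y c\<close>, which gives \<open>x\<close> directly.\<close>
  have "cd_add x (cd_scale (- 1) (cd_mult \<gamma> n y c)) = cd_zero n \<longleftrightarrow> x = cd_mult \<gamma> n y c"
    by (auto simp: cd_scale_minus_one_inject cd_add_eq_zero_iff carr)
  then show "cd_mult \<gamma> (Suc n) (CD_Pair x y) (CD_Pair c (cd_one n)) = cd_zero (Suc n) \<longleftrightarrow>
      x = cd_mult \<gamma> n y c \<and> (\<gamma> n = cd_norm \<gamma> n c \<or> y = cd_zero n)"
    using coef[of y]
    by (auto simp: cd_mult_one carr sq_right cc cd_mult_scale)
qed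

lemma cd_zero_divisor_pair_one_iff:
  assumes c: "c \<in> pm (cd_E' n)"
  shows "cd_zero_divisor \<gamma> (Suc n) (CD_Pair c (cd_one n)) \<longleftrightarrow> \<gamma> n = cd_norm \<gamma> n c"
proof
  have cC: "c \<in> cd_carrier n" using c cd_pm_E'_subset cd_pm_E_carrier by blast
  {
    assume "cd_zero_divisor \<gamma> (Suc n) (CD_Pair c (cd_one n))"
    then obtain x y where xy: "x \<in> cd_carrier n" "y \<in> cd_carrier n"
      and nz: "CD_Pair x y \<noteq> cd_zero (Suc n)"
      and "cd_mult \<gamma> (Suc n) (CD_Pair c (cd_one n)) (CD_Pair x y) = cd_zero (Suc n) \<or>
        cd_mult \<gamma> (Suc n) (CD_Pair x y) (CD_Pair c (cd_one n)) = cd_zero (Suc n)"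
      by (auto simp: cd_zero_divisor_def simp del: cd_mult.simps)
    then have "(x = cd_mult \<gamma> n c (cd_conj y) \<or> x = cd_mult \<gamma> n y c) \<and>
        (\<gamma> n = cd_norm \<gamma> n c \<or> y = cd_zero n)"
      using cd_pair_one_mult_eq_zero_iff[OF c xy] by blast
    \<comment> \<open>If \<open>y\<close> were zero, then \<open>x\<close>, a product with
      \<open>y\<close>, would vanish too, and so would the whole pair.\<close>
    then show "\<gamma> n = cd_norm \<gamma> n c"
      using nz cC by (auto simp: cd_mult_zero)
  }
  \<comment> \<open>Conversely \<open>(c, 1)\<close> annihilates itself: \<open>x = c\<close> and
    \<open>y = 1\<close> satisfy \<open>x = y c\<close>.\<close>
  assume "\<gamma> n = cd_norm \<gamma> n c"
  then have "cd_mult \<gamma> (Suc n) (CD_Pair c (cd_one n)) (CD_Pair c (cd_one n)) = cd_zero (Suc n)"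
    using cd_pair_one_mult_eq_zero_iff(2)[OF c cC cd_one_carrier, of \<gamma>]
    by (simp add: cd_mult_one cC del: cd_mult.simps)
  moreover have "CD_Pair c (cd_one n) \<in> cd_carrier (Suc n)"
    "CD_Pair c (cd_one n) \<noteq> cd_zero (Suc n)"
    by (simp_all add: cC cd_one_carrier cd_one_neq_zero)
  ultimately show "cd_zero_divisor \<gamma> (Suc n) (CD_Pair c (cd_one n))"
    unfolding cd_zero_divisor_def by blast
qed

section \<open>Sign changes and membership in \<open>pm (cd_Z' \<gamma> n)\<close>\<close>

lemma cd_zero_divisor_neg:
  assumes "cd_zero_divisor \<gamma> k x"
  shows "cd_zero_divisor \<gamma> k (cd_neg x)"
proof -
  obtain y where x: "x \<in> cd_carrier k" "x \<noteq> cd_zero k" and y: "y \<in> cd_carrier k" "y \<noteq> cd_zero k"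
    and xy: "cd_mult \<gamma> k x y = cd_zero k \<or> cd_mult \<gamma> k y x = cd_zero k"
    using assms unfolding cd_zero_divisor_def by blast
  have "cd_neg x \<in> cd_carrier k" "cd_neg x \<noteq> cd_zero k"
    using x by (simp_all add: cd_neg_def cd_scale_carrier cd_scale_eq_zero_iff)
  moreover have "cd_mult \<gamma> k (cd_neg x) y = cd_zero k \<or> cd_mult \<gamma> k y (cd_neg x) = cd_zero k"
    using xy by (auto simp: cd_neg_def cd_mult_scale x y)
  ultimately show ?thesis
    using y unfolding cd_zero_divisor_def by blast
qed

lemma cd_neg_neg [simp]: "cd_neg (cd_neg x) = x"
  by (simp add: cd_neg_def cd_scale_scale)

lemma cd_pm_neg_iff: "cd_neg x \<in> pm X \<longleftrightarrow> x \<in> pm X"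
  by (auto simp: pm_def image_iff) (metis cd_neg_neg)+

lemma cd_neg_Pair: "cd_neg (CD_Pair a b) = CD_Pair (cd_neg a) (cd_neg b)"
  by (simp add: cd_neg_def)

text \<open>In \<open>cd_Z'\<close> only the first component has a prescribed sign. The sign of the
  pair can thus be chosen to suit \<open>a\<close>, while \<open>pm (cd_E n)\<close> and the
  property of being a zero divisor are stable under negation.\<close>

lemma cd_pm_Z'_iff:
  "CD_Pair a b \<in> pm (cd_Z' \<gamma> n) \<longleftrightarrow>
   a \<in> pm (cd_E' n) \<and> b \<in> pm (cd_E n) \<and> cd_zero_divisor \<gamma> (Suc n) (CD_Pair a b)"
proof
  assume "CD_Pair a b \<in> pm (cd_Z' \<gamma> n)"
  then consider "CD_Pair a b \<in> cd_Z' \<gamma> n" | z where "z \<in> cd_Z' \<gamma> n" "CD_Pair a b = cd_neg z"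
    by (auto simp: pm_def)
  then show "a \<in> pm (cd_E' n) \<and> b \<in> pm (cd_E n) \<and> cd_zero_divisor \<gamma> (Suc n) (CD_Pair a b)"
  proof cases
    case 1
    then show ?thesis by (auto simp: cd_Z'_def pm_def)
  next
    case 2
    then obtain x y where "x \<in> cd_E' n" "y \<in> pm (cd_E n)" "a = cd_neg x" "b = cd_neg y"
      and "cd_zero_divisor \<gamma> (Suc n) (CD_Pair x y)"
      by (auto simp: cd_Z'_def cd_neg_Pair)
    then show ?thesis
      using cd_zero_divisor_neg[of \<gamma> "Suc n" "CD_Pair x y"]
      by (simp add: cd_pm_neg_iff cd_neg_Pair) (simp add: pm_def)
  qed
next
  assume *: "a \<in> pm (cd_E' n) \<and> b \<in> pm (cd_E n) \<and> cd_zero_divisor \<gamma> (Suc n) (CD_Pair a b)"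
  then consider "a \<in> cd_E' n" | "cd_neg a \<in> cd_E' n"
    by (auto simp: pm_def)
  then show "CD_Pair a b \<in> pm (cd_Z' \<gamma> n)"
  proof cases
    case 1
    then have "CD_Pair a b \<in> cd_Z' \<gamma> n"
      using * by (simp add: cd_Z'_def)
    then show ?thesis by (simp add: pm_def)
  next
    case 2
    then have "cd_neg (CD_Pair a b) \<in> cd_Z' \<gamma> n"
      using * cd_zero_divisor_neg[of \<gamma> "Suc n" "CD_Pair a b"]
      by (auto simp: cd_Z'_def cd_pm_neg_iff cd_neg_Pair)
    then have "cd_neg (CD_Pair a b) \<in> pm (cd_Z' \<gamma> n)"
      by (simp add: pm_def)
    then show ?thesis by (simp only: cd_pm_neg_iff)
  qed
qed

section \<open>Elements orthogonal to \<open>(c, 1)\<close>\<close>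

lemma cd_orthogonal_pair_one_iff:
  assumes c: "c \<in> pm (cd_E' n)" and a: "a \<in> pm (cd_E' n)" and b: "b \<in> pm (cd_E n)"
    and \<gamma>c: "\<gamma> n = cd_norm \<gamma> n c" and nb: "cd_norm \<gamma> n b \<noteq> 0"
  shows "cd_orthogonal \<gamma> (Suc n) (CD_Pair c (cd_one n)) (CD_Pair a b) \<longleftrightarrow>
    cd_mult \<gamma> n a b = cd_scale (cd_norm \<gamma> n b) c"
proof -
  have cC: "c \<in> cd_carrier n" and aC: "a \<in> cd_carrier n" and bC: "b \<in> cd_carrier n"
    using a b c cd_pm_E'_subset cd_pm_E_carrier by blast+
  note carr = cC aC bC cd_mult_carrier cd_conj_carrier cd_scale_carrier
  have "cd_conj (cd_mult \<gamma> n c (cd_conj b)) = cd_scale (- 1) (cd_mult \<gamma> n b c)"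
    by (simp add: cd_conj_mult carr cd_pm_E'_conj[OF c] cd_mult_scale)
  \<comment> \<open>Conjugation negates the imaginary \<open>a\<close> and sends
    \<open>c (cnj b)\<close> to \<open>- b c\<close>, so vanishing of one product entails vanishing
    of the other.\<close>
  then have bc: "a = cd_mult \<gamma> n b c" if "a = cd_mult \<gamma> n c (cd_conj b)"
    using that cd_pm_E'_conj[OF a] by (simp add: cd_scale_minus_one_inject)
  have "cd_orthogonal \<gamma> (Suc n) (CD_Pair c (cd_one n)) (CD_Pair a b) \<longleftrightarrow>
      a = cd_mult \<gamma> n c (cd_conj b)"
    unfolding cd_orthogonal_def cd_pair_one_mult_eq_zero_iff[OF c aC bC] using \<gamma>c bc by blast
  also have "\<dots> \<longleftrightarrow> cd_mult \<gamma> n a b = cd_scale (cd_norm \<gamma> n b) c"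
  proof
    assume "a = cd_mult \<gamma> n c (cd_conj b)"
    then show "cd_mult \<gamma> n a b = cd_scale (cd_norm \<gamma> n b) c"
      by (simp add: cd_pm_E_cancel(3)[OF b cC])
  next
    assume "cd_mult \<gamma> n a b = cd_scale (cd_norm \<gamma> n b) c"
    \<comment> \<open>Right multiplication by \<open>cnj b\<close> turns \<open>a b\<close> into
      \<open>n(b) a\<close>; the nonzero factor \<open>n(b)\<close> is then divided out.\<close>
    then have "cd_scale (cd_norm \<gamma> n b) a =
        cd_scale (cd_norm \<gamma> n b) (cd_mult \<gamma> n c (cd_conj b))"
      using cd_pm_E_cancel(2)[OF b aC, of \<gamma>] by (simp add: cd_mult_scale carr)
    then have "cd_scale (1 / cd_norm \<gamma> n b) (cd_scale (cd_norm \<gamma> n b) a) =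
        cd_scale (1 / cd_norm \<gamma> n b) (cd_scale (cd_norm \<gamma> n b) (cd_mult \<gamma> n c (cd_conj b)))"
      by simp
    then show "a = cd_mult \<gamma> n c (cd_conj b)"
      using nb by (simp add: cd_scale_scale)
  qed
  finally show ?thesis .
qed

theorem lemma6p11:
  fixes \<gamma> :: "nat \<Rightarrow> real" and n :: nat and c :: cd and \<chi> :: real
  assumes "\<And>k. \<gamma> k \<in> {1, - 1}"
    and "c \<in> pm (cd_E' n)"
    and "\<chi> = \<gamma> n * (cd_norm \<gamma> n c / cd_norm \<gamma> n (cd_one n))"
  shows "\<chi> = \<gamma> n * cd_norm \<gamma> n c \<and>
    (cd_zero_divisor \<gamma> (Suc n) (CD_Pair c (cd_one n)) \<longleftrightarrow> \<chi> = 1) \<and>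
    (CD_Pair c (cd_one n) \<in> pm (cd_Z' \<gamma> n) \<longleftrightarrow> \<chi> = 1) \<and>
    (\<chi> = 1 \<longrightarrow>
      (\<forall>a b. CD_Pair a b \<in> pm (cd_Z' \<gamma> n) \<longrightarrow>
        (cd_orthogonal \<gamma> (Suc n) (CD_Pair c (cd_one n)) (CD_Pair a b) \<longleftrightarrow>
         cd_mult \<gamma> n a b = cd_scale (cd_norm \<gamma> n b) c)))"
proof -
  have \<chi>: "\<chi> = \<gamma> n * cd_norm \<gamma> n c"
    using assms(3) by simp
  have "c \<in> pm (cd_E n)"
    using assms(2) cd_pm_E'_subset by blast
  then have "cd_norm \<gamma> n c \<in> {1, - 1}"
    by (rule cd_pm_E_norm[of \<gamma>, OF assms(1)])
  \<comment> \<open>Both \<open>\<gamma> n\<close> and \<open>n(c)\<close> are 1 or -1, so their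
    product is 1 exactly when they agree.\<close>
  then have \<chi>1: "\<chi> = 1 \<longleftrightarrow> \<gamma> n = cd_norm \<gamma> n c"
    using assms(1)[of n] \<chi> by auto
  have "cd_one n \<in> pm (cd_E n)"
    by (auto simp: pm_def cd_E_def cd_one_def)
  then have "CD_Pair c (cd_one n) \<in> pm (cd_Z' \<gamma> n) \<longleftrightarrow> \<chi> = 1"
    using assms(2) by (simp add: cd_pm_Z'_iff cd_zero_divisor_pair_one_iff \<chi>1)
  moreover have "cd_orthogonal \<gamma> (Suc n) (CD_Pair c (cd_one n)) (CD_Pair a b) \<longleftrightarrow>
      cd_mult \<gamma> n a b = cd_scale (cd_norm \<gamma> n b) c"
    if "\<chi> = 1" "CD_Pair a b \<in> pm (cd_Z' \<gamma> n)" for a b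
  proof (rule cd_orthogonal_pair_one_iff[OF assms(2)])
    show "a \<in> pm (cd_E' n)" "b \<in> pm (cd_E n)" "\<gamma> n = cd_norm \<gamma> n c"
      using that by (simp_all add: cd_pm_Z'_iff \<chi>1)
    then show "cd_norm \<gamma> n b \<noteq> 0"
      using cd_pm_E_norm[of \<gamma> b n, OF assms(1)] by auto
  qed
  ultimately show ?thesis
    using \<chi> \<chi>1 cd_zero_divisor_pair_one_iff[OF assms(2)] by blast
qed

end
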